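(* Let $\mathcal{M}_1,\ldots,\mathcal{M}_m$ be finite collections of absolutely continuous (finite) measures on $[0,1]$, let $n$ be a positive integer, and let $k_1,\ldots,k_m$ be positive integers with $k_1+\cdots+k_m=m+n-1$. Then there exists a partition of $[0,1]$ into $n$ intervals $I_1,\ldots,I_n$ such that, for each $i\in[m]$, at least one of the following holds: (a) $\mu\left(\bigcup_{j\text{ odd}}I_j\right)=\mu\left(\bigcup_{j\text{ even}}I_j\right)$ for all $\mu\in\mathcal{M}_i$; (b) the equality $$\mu\Big(\bigcup_{j\text{ odd}}I_j\Big)-\mu\Big(\bigcup_{j\text{ even}}I_j\Big)=\pm\max_{\mu'\in\mathcal{M}_i}\left|\mu'\Big(\bigcup_{j\text{ odd}}I_j\Big)-\mu'\Big(\bigcup_{j\text{ even}}I_j\Big)\right|$$ holds for at least $k_i$ measures $\mu\in\mathcal{M}_i$, with each of the signs $+$ and $-$ being attained by at least $\lfloor k_i/2\rfloor$ of these measures.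
   Context: Measures are absolutely continuous with respect to Lebesgue measure (not necessarily probability measures). The intervals $I_1,\ldots,I_n$ of the partition are not required to be numbered from left to right, and may be empty or degenerate; whether endpoints belong to an interval does not matter. *)

theory Defs
  imports "HOL-Probability.Probability"
begin

definition ac_measure_01 :: "real measure \<Rightarrow> bool" where
  "ac_measure_01 \<mu> \<longleftrightarrow>
     sets \<mu> = sets (restrict_space borel {0..1::real}) \<and>
     finite_measure \<mu> \<and>
     absolutely_continuous (restrict_space lborel {0..1::real}) \<mu>"

text \<open>A partition of [0,1] into n intervals I 1, ..., I n (in any order, possibly
  empty or degenerate).\<close>
definition interval_partition_01 :: "nat \<Rightarrow> (nat \<Rightarrow> real set) \<Rightarrow> bool" where
  "interval_partition_01 n I \<longleftrightarrow>
     (\<forall>j\<in>{1..n}. is_interval (I j)) \<and>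
     (\<forall>j\<in>{1..n}. \<forall>j'\<in>{1..n}. j \<noteq> j' \<longrightarrow> I j \<inter> I j' = {}) \<and>
     (\<Union>j\<in>{1..n}. I j) = {0..1}"

definition odd_part :: "nat \<Rightarrow> (nat \<Rightarrow> real set) \<Rightarrow> real set" where
  "odd_part n I = (\<Union>j\<in>{j\<in>{1..n}. odd j}. I j)"

definition even_part :: "nat \<Rightarrow> (nat \<Rightarrow> real set) \<Rightarrow> real set" where
  "even_part n I = (\<Union>j\<in>{j\<in>{1..n}. even j}. I j)"

definition disc :: "nat \<Rightarrow> (nat \<Rightarrow> real set) \<Rightarrow> real measure \<Rightarrow> real" where
  "disc n I \<mu> = measure \<mu> (odd_part n I) - measure \<mu> (even_part n I)"

end

theory Submission
  imports Defs "HOL-Library.Z2" "HOL-Library.Sublist"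
begin

text \<open>
  A sign function on $[0,1)$ with at most $d$ sign changes is a point of a $d$-sphere with antipodal
  map $s \mapsto \neg s$. The hemispheres $c_d$ are built as fine chains mod 2: $c_0$ is the constant
  function $+$, and $c_{d+1}$ is the cone over $c_d + \neg c_d$ along the contraction that overwrites
  longer and longer initial segments by $+$. Since $\partial c_{d+1} = c_d + \neg c_d$, Fan's parity
  count of alternating simplices yields Tucker's lemma on these chains, and refining the mesh yields
  a Borsuk-Ulam theorem for partitions by $d$ cuts.

  For a list $D$ of discrepancies let $A_r(D)$ be the largest alternating sum over its subsequences
  of length $r$, and consider the odd function $A_r(D) - A_r(-D)$. If it vanishes for
  $1 \le r < k$ and $D \neq 0$, then by induction on $r$ some subsequence of length $k$
  attains $\pm\max|D|$ with alternating signs: where the extremal subsequences of length $r$ of both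
  initial signs exist, the earlier starting element of one extends the other. Over all collections
  this imposes $\sum_i (k_i - 1) = n - 1$ odd conditions, as many as there are cuts.
\<close>

section \<open>Alternating sums\<close>

primrec altsum :: "real list \<Rightarrow> real" where
  "altsum [] = 0"
| "altsum (y # ys) = y - altsum ys"

text \<open>The equality case of the bound in \<open>altsum_bound\<close>. \<open>M\<close> may be
  negative and carries the sign of the first entry.\<close>

primrec extremal :: "('a \<Rightarrow> real) \<Rightarrow> real \<Rightarrow> 'a list \<Rightarrow> bool" where
  "extremal D M [] \<longleftrightarrow> True"
| "extremal D M (z # zs) \<longleftrightarrow> D z = M \<and> extremal D (- M) zs"

definition max_altsum :: "nat \<Rightarrow> ('a \<Rightarrow> real) \<Rightarrow> 'a list \<Rightarrow> real" where
  "max_altsum r D xs = Max ((\<lambda>zs. altsum (map D zs)) ` {zs. subseq zs xs \<and> length zs = r})"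

text \<open>If \<open>xs\<close> has no subsequence of length \<open>r\<close>, both terms are the
  same unspecified \<open>Max {}\<close>, so the difference is 0.\<close>

definition imbalance :: "nat \<Rightarrow> ('a \<Rightarrow> real) \<Rightarrow> 'a list \<Rightarrow> real" where
  "imbalance r D xs = max_altsum r D xs - max_altsum r (\<lambda>x. - D x) xs"

lemma finite_subseq: "finite {zs. subseq zs xs \<and> length zs = r}"
  by (rule finite_subset[of _ "set (List.subseqs xs)"]) auto

lemma subseq_set_subset: "subseq zs xs \<Longrightarrow> set zs \<subseteq> set xs"
  by (auto elim: list_emb_set)

lemma altsum_bound:
  "(\<And>z. z \<in> set zs \<Longrightarrow> \<bar>D z\<bar> \<le> M) \<Longrightarrow> \<bar>altsum (map D zs)\<bar> \<le> real (length zs) * M"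
proof (induction zs)
  case (Cons z zs)
  then have "\<bar>D z\<bar> \<le> M" "\<bar>altsum (map D zs)\<bar> \<le> real (length zs) * M"
    by auto
  then show ?case
    by (simp add: algebra_simps)
qed simp

lemma extremal_altsum: "extremal D M zs \<Longrightarrow> altsum (map D zs) = real (length zs) * M"
  by (induction zs arbitrary: M) (auto simp: algebra_simps)

text \<open>The triangle inequality is tight: head and tail reach the extreme value together only if
  each attains its own bound with the matching sign.\<close>

lemma altsum_extremal:
  "(\<And>z. z \<in> set zs \<Longrightarrow> \<bar>D z\<bar> \<le> \<bar>M\<bar>) \<Longrightarrow> altsum (map D zs) = real (length zs) * M \<Longrightarrow> extremal D M zs"
proof (induction zs arbitrary: M)
  case (Cons z zs)
  then have bounds: "\<bar>D z\<bar> \<le> \<bar>M\<bar>" "\<bar>altsum (map D zs)\<bar> \<le> real (length zs) * \<bar>M\<bar>"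
    by (auto intro!: altsum_bound)
  have eq: "D z - altsum (map D zs) = M + real (length zs) * M"
    using Cons.prems(2) by (simp add: algebra_simps)
  have "D z = M \<and> altsum (map D zs) = - (real (length zs) * M)"
    using bounds eq by (cases "M \<ge> 0") (auto simp: abs_if split: if_splits)
  with Cons show ?case
    by simp
qed simp

lemma extremal_uminus: "extremal (\<lambda>x. - D x) M zs \<longleftrightarrow> extremal D (- M) zs"
  by (induction zs arbitrary: M) (auto simp: minus_equation_iff)

lemma max_altsum_eq:
  assumes "\<And>x. x \<in> set xs \<Longrightarrow> \<bar>D x\<bar> \<le> M" "subseq zs xs" "length zs = r" "extremal D M zs"
  shows "max_altsum r D xs = real r * M"
  unfolding max_altsum_def
proof (rule Max_eqI)
  show "finite ((\<lambda>zs. altsum (map D zs)) ` {zs. subseq zs xs \<and> length zs = r})"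
    by (intro finite_imageI finite_subseq)
  show "real r * M \<in> (\<lambda>zs. altsum (map D zs)) ` {zs. subseq zs xs \<and> length zs = r}"
    using assms(2-4) extremal_altsum[of D M zs] by force
next
  fix y assume "y \<in> (\<lambda>zs. altsum (map D zs)) ` {zs. subseq zs xs \<and> length zs = r}"
  then obtain ws where "subseq ws xs" "length ws = r" "y = altsum (map D ws)"
    by blast
  moreover have "\<bar>altsum (map D ws)\<bar> \<le> real (length ws) * M"
    using subseq_set_subset[OF \<open>subseq ws xs\<close>] by (intro altsum_bound assms(1)) auto
  ultimately show "y \<le> real r * M"
    by simp
qed

lemma max_altsum_attained:
  assumes "subseq zs xs" "length zs = r"
  obtains ws where "subseq ws xs" "length ws = r" "altsum (map D ws) = max_altsum r D xs"
proof -
  have "max_altsum r D xs \<in> (\<lambda>zs. altsum (map D zs)) ` {zs. subseq zs xs \<and> length zs = r}"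
    unfolding max_altsum_def using assms by (intro Max_in finite_imageI finite_subseq) auto
  then show ?thesis
    using that by auto
qed

text \<open>Whichever of the two sequences starts first supplies a new first element for the other.\<close>

lemma extremal_combine:
  assumes "subseq zs xs" "subseq zs' xs" "extremal D M zs" "extremal D (- M) zs'"
    and "length zs = length zs'" "zs \<noteq> []" "M \<noteq> 0"
  shows "\<exists>ws. subseq ws xs \<and> length ws = Suc (length zs) \<and> (extremal D M ws \<or> extremal D (- M) ws)"
  using assms(1,2)
proof (induction xs rule: list.induct)
  case Nil
  with \<open>zs \<noteq> []\<close> show ?case
    by simp
next
  case (Cons a xs)
  have cases: "subseq ys xs \<or> (\<exists>ys'. ys = a # ys')" if "subseq ys (a # xs)" for ys
    using that by (cases ys) (auto split: if_splits)
  consider "subseq zs xs" "subseq zs' xs" | "subseq zs xs" "hd zs' = a" "zs' \<noteq> []"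
    | "subseq zs' xs" "hd zs = a" | "hd zs = a" "hd zs' = a" "zs' \<noteq> []"
    using cases[OF Cons.prems(1)] cases[OF Cons.prems(2)] by auto
  then show ?case
  proof cases
    case 1
    from Cons.IH[OF this] show ?thesis
      by (blast intro: list_emb_Cons)
  next
    case 2
    with assms(3-6) show ?thesis
      by (intro exI[of _ "a # zs"]) (cases zs'; auto)
  next
    case 3
    with assms(3-6) show ?thesis
      by (intro exI[of _ "a # zs'"]) (cases zs; auto)
  next
    \<comment> \<open>If both began at \<open>a\<close>, then \<open>M = D a = - M\<close>, against
      \<open>M \<noteq> 0\<close>.\<close>
    case 4
    with assms(3-7) show ?thesis
      by (cases zs; cases zs') auto
  qed
qed

lemma imbalance_uminus: "imbalance r (\<lambda>x. - D x) xs = - imbalance r D xs"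
  by (simp add: imbalance_def)

text \<open>A zero imbalance passes the maximum \<open>length zs * M\<close> on to
  \<open>- D\<close>. A maximizer for \<open>- D\<close> is extremal by
  \<open>altsum_extremal\<close>, so for \<open>D\<close> it alternates with the opposite first
  sign, and the two sequences combine.\<close>

lemma extremal_extend:
  assumes "\<And>x. x \<in> set xs \<Longrightarrow> \<bar>D x\<bar> \<le> M" "M > 0" "imbalance (length zs) D xs = 0"
    and "subseq zs xs" "zs \<noteq> []" "extremal D M zs"
  shows "\<exists>ws. subseq ws xs \<and> length ws = Suc (length zs) \<and> (extremal D M ws \<or> extremal D (- M) ws)"
proof -
  have "max_altsum (length zs) (\<lambda>x. - D x) xs = real (length zs) * M"
    using max_altsum_eq[of xs D M zs] assms by (simp add: imbalance_def)
  with max_altsum_attained[OF assms(4) refl, of "\<lambda>x. - D x"] obtain zs' where zs': "subseq zs' xs"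
      "length zs' = length zs" "altsum (map (\<lambda>x. - D x) zs') = real (length zs') * M"
    by metis
  have "extremal (\<lambda>x. - D x) M zs'"
    using zs'(1,3) assms(1,2) by (intro altsum_extremal) (auto dest: subseq_set_subset)
  then have "extremal D (- M) zs'"
    by (simp add: extremal_uminus)
  with zs' assms show ?thesis
    by (intro extremal_combine[of zs xs zs' D M]) auto
qed

text \<open>An element of maximal \<open>\<bar>D\<bar>\<close> starts the induction, and each
  vanishing imbalance buys one further entry. The first sign is not controlled; the case
  \<open>- M\<close> is reduced to \<open>M\<close> by passing to \<open>- D\<close>.\<close>

lemma imbalance_zero_extremal:
  assumes bound: "\<And>x. x \<in> set xs \<Longrightarrow> \<bar>D x\<bar> \<le> M" and "M > 0" and "x \<in> set xs" "\<bar>D x\<bar> = M"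
    and zero: "\<And>r. r \<in> {1..<k} \<Longrightarrow> imbalance r D xs = 0" and "1 \<le> k"
  shows "\<exists>ws. subseq ws xs \<and> length ws = k \<and> (extremal D M ws \<or> extremal D (- M) ws)"
  using \<open>1 \<le> k\<close> zero
proof (induction k rule: dec_induct)
  case base
  have "subseq [x] xs"
    using \<open>x \<in> set xs\<close> by (simp add: subseq_singleton_left)
  with assms(2,4) show ?case
    by (intro exI[of _ "[x]"]) (auto simp: abs_if split: if_splits)
next
  case (step r)
  then obtain zs where zs: "subseq zs xs" "length zs = r" "extremal D M zs \<or> extremal D (- M) zs"
    by auto
  have ne: "zs \<noteq> []" and bal: "imbalance (length zs) D xs = 0"
    using zs(2) step by auto
  from zs(3) show ?case
  proof
    assume "extremal D M zs"
    from extremal_extend[OF bound assms(2) bal zs(1) ne this] show ?thesis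
      using zs(2) by simp
  next
    assume "extremal D (- M) zs"
    then have "extremal (\<lambda>x. - D x) M zs"
      by (simp add: extremal_uminus)
    from extremal_extend[of xs "\<lambda>x. - D x" M zs, OF _ assms(2) _ zs(1) ne this] show ?thesis
      using zs(2) bal bound by (auto simp: imbalance_uminus extremal_uminus)
  qed
qed

lemma extremal_filter_length:
  assumes "extremal D M zs" "M \<noteq> 0"
  shows "length zs div 2 \<le> length (filter (\<lambda>z. D z = M) zs)"
    and "length (filter (\<lambda>z. D z = - M) zs) = length zs div 2"
    and "set zs \<subseteq> {z. D z = M \<or> D z = - M}"
proof -
  \<comment> \<open>Exact counts carry the induction: passing to the tail replaces \<open>M\<close>
    by \<open>- M\<close> and so exchanges rounding up and rounding down.\<close>
  have "length (filter (\<lambda>z. D z = M) zs) = Suc (length zs) div 2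
      \<and> length (filter (\<lambda>z. D z = - M) zs) = length zs div 2 \<and> set zs \<subseteq> {z. D z = M \<or> D z = - M}"
    using assms
  proof (induction zs arbitrary: M)
    case (Cons z zs)
    from Cons.prems Cons.IH[of "- M"] show ?case
      by auto
  qed simp
  then show "length zs div 2 \<le> length (filter (\<lambda>z. D z = M) zs)"
    and "length (filter (\<lambda>z. D z = - M) zs) = length zs div 2"
    and "set zs \<subseteq> {z. D z = M \<or> D z = - M}"
    by (auto intro: div_le_mono)
qed

text \<open>Distinctness turns positions of \<open>zs\<close> into elements of \<open>A\<close>;
  rounding down makes the bounds independent of the first sign.\<close>

lemma extremal_card:
  assumes "finite A" "set zs \<subseteq> A" "distinct zs" "extremal D M zs \<or> extremal D (- M) zs" "M \<noteq> 0"
  shows "length zs \<le> card {x \<in> A. D x = M \<or> D x = - M}"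
    and "length zs div 2 \<le> card {x \<in> A. D x = M}"
    and "length zs div 2 \<le> card {x \<in> A. D x = - M}"
proof -
  have filter: "length zs div 2 \<le> length (filter (\<lambda>z. D z = M) zs)"
      "length zs div 2 \<le> length (filter (\<lambda>z. D z = - M) zs)"
      "set zs \<subseteq> {z. D z = M \<or> D z = - M}"
    using assms(4,5) extremal_filter_length[of D M zs] extremal_filter_length[of D "- M" zs] by auto
  have card: "length (filter P zs) \<le> card {x \<in> A. P x}" for P
  proof -
    have "length (filter P zs) = card (set (filter P zs))"
      using \<open>distinct zs\<close> by (metis distinct_card distinct_filter)
    also have "\<dots> \<le> card {x \<in> A. P x}"
      using assms(1,2) by (intro card_mono) auto
    finally show ?thesis .
  qed
  have "filter (\<lambda>z. D z = M \<or> D z = - M) zs = zs"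
    using filter(3) by (intro filter_True) auto
  with card[of "\<lambda>z. D z = M \<or> D z = - M"] show "length zs \<le> card {x \<in> A. D x = M \<or> D x = - M}"
    by simp
  show "length zs div 2 \<le> card {x \<in> A. D x = M}"
    using filter(1) card[of "\<lambda>z. D z = M"] by simp
  show "length zs div 2 \<le> card {x \<in> A. D x = - M}"
    using filter(2) card[of "\<lambda>z. D z = - M"] by simp
qed

section \<open>Continuity of the imbalances in the discrepancies\<close>

lemma tendsto_Max:
  fixes f :: "'a \<Rightarrow> 'b \<Rightarrow> real"
  assumes "finite S" "S \<noteq> {}" "\<And>s. s \<in> S \<Longrightarrow> ((\<lambda>x. f x s) \<longlongrightarrow> l s) F"
  shows "((\<lambda>x. Max (f x ` S)) \<longlongrightarrow> Max (l ` S)) F"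
  using assms
proof (induction S rule: finite_ne_induct)
  case (insert s S)
  then have "((\<lambda>x. max (f x s) (Max (f x ` S))) \<longlongrightarrow> max (l s) (Max (l ` S))) F"
    by (intro tendsto_max) auto
  with insert show ?case
    by simp
qed simp

lemma tendsto_altsum:
  "(\<And>z. z \<in> set zs \<Longrightarrow> ((\<lambda>n. D n z) \<longlongrightarrow> D' z) F) \<Longrightarrow>
    ((\<lambda>n. altsum (map (D n) zs)) \<longlongrightarrow> altsum (map D' zs)) F"
  by (induction zs) (auto intro!: tendsto_intros)

lemma tendsto_max_altsum:
  assumes "\<And>z. z \<in> set xs \<Longrightarrow> ((\<lambda>n. D n z) \<longlongrightarrow> D' z) F"
  shows "((\<lambda>n. max_altsum r (D n) xs) \<longlongrightarrow> max_altsum r D' xs) F"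
proof (cases "{zs. subseq zs xs \<and> length zs = r} = {}")
  case True
  then show ?thesis
    unfolding max_altsum_def True by simp
next
  case False
  then show ?thesis
    unfolding max_altsum_def using assms
    by (intro tendsto_Max finite_subseq tendsto_altsum) (auto dest: subseq_set_subset)
qed

lemma tendsto_imbalance:
  assumes "\<And>z. z \<in> set xs \<Longrightarrow> ((\<lambda>n. D n z) \<longlongrightarrow> D' z) F"
  shows "((\<lambda>n. imbalance r (D n) xs) \<longlongrightarrow> imbalance r D' xs) F"
  unfolding imbalance_def using assms by (intro tendsto_diff tendsto_max_altsum tendsto_minus)

section \<open>Chains modulo 2\<close>

text \<open>These rules rewrite $+$ on bits to \<open>XOR\<close>, which disables the group laws.\<close>

declare add_bit_eq_xor [simp del] mult_bit_eq_and [simp del]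

text \<open>A simplex is the list of its vertices, a chain is a list of simplices read mod 2. A
  vertex has the empty simplex as its facet, so the boundary is the augmented one.\<close>

primrec facets :: "'a list \<Rightarrow> 'a list list" where
  "facets [] = []"
| "facets (x # xs) = xs # map ((#) x) (facets xs)"

text \<open>The standard triangulation of a prism: over vertices x_0, ..., x_n its simplices are
  \<open>f\<close> x_0, ..., \<open>f\<close> x_i, \<open>g\<close> x_i, ..., \<open>g\<close>
  x_n.\<close>

primrec prism :: "('a \<Rightarrow> 'b) \<Rightarrow> ('a \<Rightarrow> 'b) \<Rightarrow> 'a list \<Rightarrow> 'b list list" where
  "prism f g [] = []"
| "prism f g (x # xs) = (f x # map g (x # xs)) # map ((#) (f x)) (prism f g xs)"

text \<open>Equality of lists is too fine for chains mod 2, so chain identities are stated by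
  pairing both sides with an arbitrary \<open>\<phi>\<close>.\<close>

definition cochain_eval :: "('a \<Rightarrow> bit) \<Rightarrow> 'a list \<Rightarrow> bit" where
  "cochain_eval \<phi> c = (\<Sum>xs\<leftarrow>c. \<phi> xs)"

lemma bit_add_self [simp]: "x + x = (0::bit)"
  by (cases x) (auto simp: add_bit_eq_xor)

lemma bit_add_left_self [simp]: "x + (x + y) = (y::bit)"
  by (cases x) (auto simp: add_bit_eq_xor)

lemma cochain_eval_Nil [simp]: "cochain_eval \<phi> [] = 0"
  and cochain_eval_Cons [simp]: "cochain_eval \<phi> (xs # c) = \<phi> xs + cochain_eval \<phi> c"
  and cochain_eval_append [simp]: "cochain_eval \<phi> (c @ c') = cochain_eval \<phi> c + cochain_eval \<phi> c'"
  and cochain_eval_add: "cochain_eval (\<lambda>xs. \<phi> xs + \<psi> xs) c = cochain_eval \<phi> c + cochain_eval \<psi> c"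
  by (simp_all add: cochain_eval_def sum_list_addf o_def)

lemma cochain_eval_map: "cochain_eval \<phi> (map f c) = cochain_eval (\<lambda>xs. \<phi> (f xs)) c"
  by (simp add: cochain_eval_def o_def)

lemma cochain_eval_cong:
  "(\<And>xs. xs \<in> set c \<Longrightarrow> \<phi> xs = \<psi> xs) \<Longrightarrow> cochain_eval \<phi> c = cochain_eval \<psi> c"
  unfolding cochain_eval_def by (intro arg_cong[where f = sum_list] map_cong) auto

lemma cochain_eval_zero: "(\<And>xs. xs \<in> set c \<Longrightarrow> \<phi> xs = 0) \<Longrightarrow> cochain_eval \<phi> c = 0"
  by (induction c) auto

lemma cochain_eval_concat_map:
  "cochain_eval \<phi> (concat (map F c)) = cochain_eval (\<lambda>xs. cochain_eval \<phi> (F xs)) c"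
  by (induction c) auto

lemma facets_map: "facets (map f xs) = map (map f) (facets xs)"
  by (induction xs) auto

lemma length_prism: "ys \<in> set (prism f g xs) \<Longrightarrow> length ys = Suc (length xs)"
  by (induction xs arbitrary: ys) auto

text \<open>The chain homotopy formula dP + Pd = f + g mod 2. Prefixing \<open>f x\<close> is
  absorbed into the cochain, which is why the induction varies \<open>\<phi>\<close>.\<close>

lemma prism_boundary:
  "cochain_eval (\<lambda>ys. cochain_eval \<phi> (facets ys)) (prism f g xs)
     + cochain_eval (\<lambda>ys. cochain_eval \<phi> (prism f g ys)) (facets xs)
     = \<phi> (map f xs) + \<phi> (map g xs)"
proof (induction xs arbitrary: \<phi>)
  case Nil
  then show ?case by simp
next
  case (Cons x xs)
  show ?case
    using Cons.IH[of "\<lambda>zs. \<phi> (f x # zs)"]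
    by (simp add: cochain_eval_map facets_map cochain_eval_add o_def ac_simps)
qed

section \<open>Fan's parity count and Tucker's lemma\<close>

primrec alternating :: "bool list \<Rightarrow> bool \<Rightarrow> bit" where
  "alternating [] b = 1"
| "alternating (x # xs) b = (if x = b then alternating xs (\<not> b) else 0)"

text \<open>A nonempty alternating list has exactly one facet alternating from \<open>b\<close>,
  obtained by dropping an end. If another list has such a facet, it has a single pair of equal
  neighbours; deleting either gives the same facet, and the two cancel.\<close>

lemma alternating_boundary:
  "cochain_eval (\<lambda>ys. alternating ys b) (facets xs)
     = (if xs = [] then 0 else alternating xs b + alternating xs (\<not> b))"
  by (induction xs arbitrary: b) (auto simp: cochain_eval_map cochain_eval_zero ac_simps)

lemma alternating_not: "alternating (map Not xs) b = alternating xs (\<not> b)"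
  by (induction xs arbitrary: b) auto

lemma sorted_alternating_distinct:
  fixes xs :: "nat list"
  assumes "sorted xs" "alternating (map even xs) b \<noteq> 0"
  shows "distinct xs"
  using assms
proof (induction xs arbitrary: b)
  case (Cons x xs)
  then have "distinct xs"
    by (auto split: if_splits)
  moreover have "x \<notin> set xs"
  proof
    assume "x \<in> set xs"
    then obtain y ys where "xs = y # ys"
      by (cases xs) auto
    with Cons.prems \<open>x \<in> set xs\<close> show False
      by (auto split: if_splits simp: order.antisym)
  qed
  ultimately show ?case
    by simp
qed simp

lemma mset_facets: "mset (map mset (facets xs)) = image_mset (\<lambda>x. mset xs - {#x#}) (mset xs)"
proof (induction xs)
  case (Cons x xs)
  have "image_mset (\<lambda>y. add_mset x (mset xs) - {#y#}) (mset xs)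
      = image_mset (add_mset x) (image_mset (\<lambda>y. mset xs - {#y#}) (mset xs))"
    unfolding multiset.map_comp o_def by (intro image_mset_cong) (auto simp: multiset_eq_iff)
  also have "\<dots> = mset (map mset (map ((#) x) (facets xs)))"
    unfolding Cons.IH[symmetric] by (simp add: multiset.map_comp o_def)
  finally show ?case
    by simp
qed simp

lemma sorted_facets: "sorted xs \<Longrightarrow> ys \<in> set (facets xs) \<Longrightarrow> sorted ys \<and> set ys \<subseteq> set xs"
  by (induction xs arbitrary: ys) (simp, fastforce)

text \<open>By \<open>mset_facets\<close>, the facets up to order of vertices depend only on the
  multiset of vertices.\<close>

lemma cochain_eval_facets_sort:
  fixes xs :: "'a::linorder list"
  shows "cochain_eval (\<lambda>ys. \<phi> (sort ys)) (facets xs) = cochain_eval \<phi> (facets (sort xs))"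
proof -
  have eq: "cochain_eval (\<lambda>ys. \<phi> (sort ys)) (facets zs)
      = sum_mset (image_mset (\<lambda>A. \<phi> (sorted_list_of_multiset A))
          (image_mset (\<lambda>x. mset zs - {#x#}) (mset zs)))" for zs :: "'a list"
    unfolding mset_facets[symmetric] cochain_eval_def
    by (simp add: sum_mset_sum_list[symmetric] multiset.map_comp o_def)
  have "cochain_eval \<phi> (facets (sort xs)) = cochain_eval (\<lambda>ys. \<phi> (sort ys)) (facets (sort xs))"
    by (intro cochain_eval_cong) (metis sorted_facets sorted_sort sorted_sort_id)
  then show ?thesis
    by (simp add: eq)
qed

text \<open>The label $\pm r$ of Tucker's lemma is encoded as $2r$ or $2r + 1$.\<close>

definition opposite :: "nat \<Rightarrow> nat" where
  "opposite l = (if even l then Suc l else l - 1)"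

lemma opposite_eqI: "x div 2 = y div 2 \<Longrightarrow> x \<noteq> y \<Longrightarrow> opposite x = y"
  unfolding opposite_def by (auto elim!: evenE oddE)

lemma even_opposite [simp]: "even (opposite l) = odd l"
  by (auto simp: opposite_def)

lemma opposite_div_2 [simp]: "opposite l div 2 = l div 2"
  by (auto simp: opposite_def elim: oddE)

text \<open>Sorting orders the encoded labels by absolute value, and even means positive. In the
  absence of opposite labels this detects Fan's alternating simplices with positive first
  sign.\<close>

definition fan_cochain :: "nat list \<Rightarrow> bit" where
  "fan_cochain xs = alternating (map even (sort xs)) True"

text \<open>Without opposite labels, \<open>x div 2\<close> decides the order of distinct labels, so
  \<open>opposite\<close> keeps the order and flips all signs. The second term thus detects
  alternation from a negative sign, and \<open>alternating_boundary\<close> applies.\<close>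

lemma fan_coboundary:
  assumes "xs \<noteq> []" and no_opp: "\<And>x y. x \<in> set xs \<Longrightarrow> y \<in> set xs \<Longrightarrow> y \<noteq> opposite x"
  shows "cochain_eval fan_cochain (facets xs) = fan_cochain xs + fan_cochain (map opposite xs)"
proof -
  have mono: "opposite x \<le> opposite y" if "x \<in> set xs" "y \<in> set xs" "x \<le> y" for x y
  proof (cases "x = y")
    case False
    then have "x div 2 \<noteq> y div 2"
      using no_opp[OF that(1,2)] opposite_eqI by metis
    with \<open>x \<le> y\<close> have "x div 2 < y div 2"
      using div_le_mono le_neq_implies_less by blast
    then show ?thesis
      unfolding opposite_def by (auto elim!: oddE evenE)
  qed simp
  have "sorted (map opposite (sort xs))"
    unfolding sorted_map by (rule sorted_wrt_mono_rel[OF _ sorted_sort]) (auto intro: mono)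
  then have "sort (map opposite xs) = map opposite (sort xs)"
    by (intro properties_for_sort) auto
  then have "fan_cochain (map opposite xs) = alternating (map even (sort xs)) False"
    using alternating_not[of "map even (sort xs)" True] by (simp add: fan_cochain_def o_def)
  moreover have "sort xs \<noteq> []"
    using \<open>xs \<noteq> []\<close> by (metis length_0_conv length_sort)
  ultimately show ?thesis
    using alternating_boundary[of True "map even (sort xs)"]
      cochain_eval_facets_sort[of "\<lambda>ys. alternating (map even ys) True" xs]
    by (simp add: fan_cochain_def[abs_def] facets_map cochain_eval_map)
qed

text \<open>Pigeonhole: alternation makes the labels distinct, the absence of opposite labels makes
  \<open>x div 2\<close> injective on them, and it has only \<open>d\<close> values.\<close>

lemma fan_cochain_eq_0:
  assumes "\<And>x y. x \<in> set xs \<Longrightarrow> y \<in> set xs \<Longrightarrow> y \<noteq> opposite x"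
    and "\<And>x. x \<in> set xs \<Longrightarrow> x div 2 < d" and "d < length xs"
  shows "fan_cochain xs = 0"
proof (rule ccontr)
  assume "fan_cochain xs \<noteq> 0"
  then have "distinct xs"
    unfolding fan_cochain_def using sorted_alternating_distinct[of "sort xs" True] by auto
  then have "length xs = card (set xs)"
    by (simp add: distinct_card)
  also have "\<dots> \<le> card {..<d}"
    using assms(1,2) opposite_eqI by (intro card_inj_on_le[where f = "\<lambda>x. x div 2"] inj_onI) (auto, metis)
  finally show False
    using \<open>d < length xs\<close> by simp
qed

section \<open>Hemispheres as iterated cones along a contraction\<close>

locale antipodal_contraction =
  fixes nu :: "'v \<Rightarrow> 'v" and h :: "nat \<Rightarrow> 'v \<Rightarrow> 'v" and N :: nat and pt :: 'v
  assumes nu_nu [simp]: "nu (nu v) = v"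
    and h_0 [simp]: "h 0 v = v"
    and h_N [simp]: "h N v = pt"
begin

text \<open>Each simplex involves just two consecutive stages of \<open>h\<close>, so it stays small
  when the steps of \<open>h\<close> are small.\<close>

definition cone :: "'v list \<Rightarrow> 'v list list" where
  "cone xs = concat (map (\<lambda>q. prism (h (Suc q)) (h q) xs) [0..<N])"

primrec hemisphere :: "nat \<Rightarrow> 'v list list" where
  "hemisphere 0 = [[pt]]"
| "hemisphere (Suc d) = concat (map cone (hemisphere d @ map (map nu) (hemisphere d)))"

lemma length_hemisphere: "xs \<in> set (hemisphere d) \<Longrightarrow> length xs = Suc d"
  by (induction d arbitrary: xs) (auto simp: cone_def dest!: length_prism)

text \<open>Summing \<open>prism_boundary\<close> over the stages telescopes, leaving the ends
  \<open>h N\<close>, constantly \<open>pt\<close>, and \<open>h 0\<close>, the identity.\<close>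

lemma cone_boundary:
  "cochain_eval (\<lambda>ys. cochain_eval \<phi> (facets ys)) (cone xs)
     + cochain_eval (\<lambda>ys. cochain_eval \<phi> (cone ys)) (facets xs)
     = \<phi> (replicate (length xs) pt) + \<phi> xs"
proof -
  have "cochain_eval (\<lambda>ys. cochain_eval \<phi> (facets ys))
            (concat (map (\<lambda>q. prism (h (Suc q)) (h q) xs) [0..<n]))
     + cochain_eval (\<lambda>ys. cochain_eval \<phi> (concat (map (\<lambda>q. prism (h (Suc q)) (h q) ys) [0..<n]))) (facets xs)
     = \<phi> (map (h n) xs) + \<phi> xs" for n
  proof (induction n)
    case 0
    then show ?case by (simp add: cochain_eval_zero)
  next
    case (Suc n)
    show ?case
      using arg_cong2[OF Suc prism_boundary[of \<phi> "h (Suc n)" "h n" xs], of "(+)"]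
      by (simp add: cochain_eval_add ac_simps)
  qed
  moreover have "map (h N) xs = replicate (length xs) pt"
    by (induction xs) auto
  ultimately show ?thesis
    unfolding cone_def by metis
qed

text \<open>The cone over a cycle is bounded by that cycle, up to constant simplices at
  \<open>pt\<close>.\<close>

lemma hemisphere_boundary:
  "cochain_eval (\<lambda>ys. cochain_eval \<phi> (facets ys)) (hemisphere (Suc d))
     = cochain_eval \<phi> (hemisphere d) + cochain_eval \<phi> (map (map nu) (hemisphere d))"
proof (induction d arbitrary: \<phi>)
  case 0
  have "cochain_eval (\<lambda>ys. cochain_eval \<phi> (facets ys)) (cone [v]) = \<phi> [pt] + \<phi> [v]" for v
    using cone_boundary[of \<phi> "[v]"] by (simp add: cone_def cochain_eval_concat_map[of _ _ "[0..<N]"] cochain_eval_zero)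
  then show ?case
    by (simp add: ac_simps)
next
  case (Suc d)
  let ?c = "hemisphere (Suc d)"
  let ?z = "?c @ map (map nu) ?c"
  \<comment> \<open>By the induction hypothesis both halves of \<open>?z\<close> have the same
    boundary, since applying \<open>nu\<close> only swaps its two summands.\<close>
  have cycle: "cochain_eval (\<lambda>ys. cochain_eval \<psi> (facets ys)) ?z = 0" for \<psi>
    using Suc[of \<psi>] Suc[of "\<lambda>xs. \<psi> (map nu xs)"]
    by (simp add: cochain_eval_map facets_map o_def del: hemisphere.simps)
  have "cochain_eval (\<lambda>ys. cochain_eval \<phi> (facets ys)) (hemisphere (Suc (Suc d)))
      = cochain_eval (\<lambda>xs. cochain_eval (\<lambda>ys. cochain_eval \<phi> (facets ys)) (cone xs)) ?z"
    by (simp only: hemisphere.simps(2)[of "Suc d"] cochain_eval_concat_map)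
  also have "\<dots> = cochain_eval (\<lambda>xs. cochain_eval (\<lambda>ys. cochain_eval \<phi> (cone ys)) (facets xs)
                      + (\<phi> (replicate (length xs) pt) + \<phi> xs)) ?z"
    by (intro cochain_eval_cong) (simp add: cone_boundary[symmetric] ac_simps)
  \<comment> \<open>\<open>xs\<close> and \<open>map nu xs\<close> have the same length, so the
    constant simplices at \<open>pt\<close> cancel between the halves of \<open>?z\<close>.\<close>
  also have "\<dots> = cochain_eval \<phi> ?z"
    using cycle by (simp add: cochain_eval_add cochain_eval_map ac_simps del: hemisphere.simps)
  finally show ?case
    by (simp del: hemisphere.simps)
qed

text \<open>Fan's count: without opposite labels, \<open>fan_coboundary\<close> and
  \<open>hemisphere_boundary\<close> carry an odd count from each dimension to the next, yet in
  dimension \<open>d\<close> the \<open>d + 1\<close> vertices share only \<open>d\<close> absolute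
  values.\<close>

lemma tucker:
  assumes odd: "\<And>d' xs x. d' \<le> d \<Longrightarrow> xs \<in> set (hemisphere d') \<Longrightarrow> x \<in> set xs \<Longrightarrow> lab (nu x) = opposite (lab x)"
    and bound: "\<And>xs x. xs \<in> set (hemisphere d) \<Longrightarrow> x \<in> set xs \<Longrightarrow> lab x div 2 < d"
  shows "\<exists>d'\<le>d. \<exists>xs\<in>set (hemisphere d'). \<exists>x\<in>set xs. \<exists>y\<in>set xs. lab y = opposite (lab x)"
proof (rule ccontr)
  assume contra: "\<not> ?thesis"
  define \<alpha> where "\<alpha> = (\<lambda>xs. fan_cochain (map lab xs))"
  have coboundary: "cochain_eval \<alpha> (facets xs) = \<alpha> xs + \<alpha> (map nu xs)"
    if "d' \<le> d" "xs \<in> set (hemisphere d')" for xs d'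
  proof -
    have "map lab (map nu xs) = map opposite (map lab xs)"
      using odd that by auto
    moreover have "xs \<noteq> []"
      using length_hemisphere[OF that(2)] by auto
    ultimately show ?thesis
      using fan_coboundary[of "map lab xs"] that contra
      by (fastforce simp: \<alpha>_def facets_map cochain_eval_map simp del: map_map)
  qed
  \<comment> \<open>This counts over the whole sphere of dimension \<open>d'\<close>. For
    \<open>d' = 0\<close>, exactly one of \<open>pt\<close> and \<open>nu pt\<close> has a positive
    label.\<close>
  have "cochain_eval \<alpha> (hemisphere d') + cochain_eval \<alpha> (map (map nu) (hemisphere d')) = 1" if "d' \<le> d" for d'
    using that
  proof (induction d')
    case 0
    then show ?case
      using coboundary[of 0 "[pt]"] by (simp add: \<alpha>_def fan_cochain_def)
  next
    case (Suc d')
    have "cochain_eval \<alpha> (hemisphere (Suc d')) + cochain_eval \<alpha> (map (map nu) (hemisphere (Suc d')))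
        = cochain_eval (\<lambda>xs. cochain_eval \<alpha> (facets xs)) (hemisphere (Suc d'))"
      unfolding cochain_eval_map cochain_eval_add[symmetric]
      by (intro cochain_eval_cong) (simp add: coboundary[OF Suc.prems])
    with Suc show ?case
      by (simp add: hemisphere_boundary del: hemisphere.simps)
  qed
  from this[of d] have "cochain_eval (\<lambda>xs. cochain_eval \<alpha> (facets xs)) (hemisphere d) = 1"
    unfolding cochain_eval_map cochain_eval_add[symmetric]
    by (metis (mono_tags, lifting) cochain_eval_cong coboundary order_refl)
  moreover have "\<alpha> xs = 0" "\<alpha> (map nu xs) = 0" if xs: "xs \<in> set (hemisphere d)" for xs
  proof -
    have "length xs = Suc d"
      by (rule length_hemisphere[OF xs])
    moreover have no_opp: "lab y \<noteq> opposite (lab x)" if "x \<in> set xs" "y \<in> set xs" for x y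
      using contra xs that by blast
    moreover have "opposite (lab y) \<noteq> opposite (opposite (lab x))" if "x \<in> set xs" "y \<in> set xs" for x y
      using no_opp[OF that] by (metis even_opposite opposite_div_2 opposite_eqI)
    ultimately show "\<alpha> xs = 0" "\<alpha> (map nu xs) = 0"
      unfolding \<alpha>_def using odd[OF order_refl xs] bound[OF xs]
      by (auto intro!: fan_cochain_eq_0[of _ d]) (metis+)
  qed
  ultimately show False
    by (simp add: coboundary[OF order_refl] cong: cochain_eval_cong) (simp add: cochain_eval_zero)
qed

end

section \<open>A Borsuk-Ulam theorem for cut vectors\<close>

lemma set_prism: "ys \<in> set (prism f g xs) \<Longrightarrow> set ys \<subseteq> f ` set xs \<union> g ` set xs"
  by (induction xs arbitrary: ys) (simp, fastforce)

text \<open>Unused cuts of a cut vector sit at 1, so that \<open>cut_sign\<close> counts finitely many cuts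
  for $x < 1$; at $x \geq 1$ its value is junk.\<close>

definition cut_sign :: "(nat \<Rightarrow> real) \<Rightarrow> real \<Rightarrow> bool" where
  "cut_sign t x \<longleftrightarrow> even (card {i. t i \<le> x})"

definition cut_vector :: "nat \<Rightarrow> (nat \<Rightarrow> real) \<Rightarrow> bool" where
  "cut_vector d t \<longleftrightarrow> (\<forall>i. t i \<in> {0..1}) \<and> (\<forall>i\<ge>d. t i = 1)"

definition cuts_near :: "real \<Rightarrow> nat \<Rightarrow> (nat \<Rightarrow> real) \<Rightarrow> (real \<Rightarrow> bool) \<Rightarrow> bool" where
  "cuts_near \<epsilon> d a s \<longleftrightarrow> (\<exists>t. cut_vector d t \<and>
     (\<forall>i. t i \<in> {a i..a i + \<epsilon>}) \<and> (\<forall>x\<in>{0..<1}. s x = cut_sign t x))"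

text \<open>One corner \<open>a\<close> serves all vertices, so any two have cut vectors that differ
  by at most \<open>\<epsilon>\<close> in every coordinate.\<close>

definition small_simplex :: "real \<Rightarrow> nat \<Rightarrow> (real \<Rightarrow> bool) list \<Rightarrow> bool" where
  "small_simplex \<epsilon> d xs \<longleftrightarrow> (\<exists>a. \<forall>s\<in>set xs. cuts_near \<epsilon> d a s)"

lemma cuts_nearE:
  assumes "cuts_near \<epsilon> d a s"
  obtains t where "cut_vector d t" "\<And>i. t i \<in> {a i..a i + \<epsilon>}"
    and "\<And>x. x \<in> {0..<1} \<Longrightarrow> s x = cut_sign t x"
  using assms by (auto simp: cuts_near_def)

lemma cuts_nearI:
  assumes "cut_vector d t" "\<And>i. t i \<in> {a i..a i + \<epsilon>}"
    and "\<And>x. x \<in> {0..<1} \<Longrightarrow> s x = cut_sign t x"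
  shows "cuts_near \<epsilon> d a s"
  unfolding cuts_near_def using assms by (intro exI[of _ t]) simp

lemma cut_vector_mono: "cut_vector d t \<Longrightarrow> d \<le> d' \<Longrightarrow> cut_vector d' t"
  by (auto simp: cut_vector_def)

lemma cuts_near_mono: "cuts_near \<epsilon> d a s \<Longrightarrow> d \<le> d' \<Longrightarrow> cuts_near \<epsilon> d' a s"
  by (erule cuts_nearE, rule cuts_nearI) (rule cut_vector_mono)

lemma small_simplex_mono: "small_simplex \<epsilon> d xs \<Longrightarrow> d \<le> d' \<Longrightarrow> small_simplex \<epsilon> d' xs"
  unfolding small_simplex_def by (blast intro: cuts_near_mono)

lemma cut_vector_finite: "cut_vector d t \<Longrightarrow> x < 1 \<Longrightarrow> finite {i. t i \<le> x}"
  by (rule finite_subset[of _ "{..<d}"]) (auto simp: cut_vector_def not_le[symmetric])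

lemma cut_vector_max:
  "cut_vector d t \<Longrightarrow> \<tau> \<in> {0..1} \<Longrightarrow> cut_vector d (\<lambda>i. max (t i) \<tau>)"
  by (auto simp: cut_vector_def max_def)

lemma cut_sign_max: "cut_sign (\<lambda>i. max (t i) \<tau>) x \<longleftrightarrow> x < \<tau> \<or> cut_sign t x"
  by (cases "x < \<tau>") (auto simp: cut_sign_def)

lemma cut_vector_case_nat:
  "cut_vector d t \<Longrightarrow> \<tau> \<in> {0..1} \<Longrightarrow> cut_vector (Suc d) (case_nat \<tau> t)"
  by (auto simp: cut_vector_def split: nat.splits)

lemma cut_sign_case_nat:
  assumes "cut_vector d t" "x < 1" "\<tau> \<le> x"
  shows "cut_sign (case_nat \<tau> t) x \<longleftrightarrow> \<not> cut_sign t x"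
proof -
  have "i \<in> {i. case_nat \<tau> t i \<le> x} \<longleftrightarrow> i \<in> insert 0 (Suc ` {i. t i \<le> x})" for i
    using assms by (cases i) auto
  then have "{i. case_nat \<tau> t i \<le> x} = insert 0 (Suc ` {i. t i \<le> x})"
    by (rule set_eqI)
  then show ?thesis
    using cut_vector_finite[OF assms(1,2)] by (simp add: cut_sign_def card_image)
qed

text \<open>Negating and then overwriting costs a single extra cut at \<open>\<tau>\<close>; hence
  one more cut per dimension.\<close>

lemma cut_sign_case_nat_max:
  assumes "cut_vector d t" "x < 1" "\<tau> \<in> {0..1}"
  shows "cut_sign (case_nat \<tau> (\<lambda>i. max (t i) \<tau>)) x \<longleftrightarrow> x < \<tau> \<or> \<not> cut_sign t x"
proof (cases "x < \<tau>")
  case True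
  then have "{i. case_nat \<tau> (\<lambda>i. max (t i) \<tau>) i \<le> x} = {}"
    by (auto split: nat.splits)
  with True show ?thesis
    by (simp add: cut_sign_def)
next
  case False
  with assms show ?thesis
    by (simp add: cut_sign_case_nat[OF cut_vector_max] cut_sign_max)
qed

text \<open>The disjunct \<open>N \<le> q\<close> makes the last stage constantly true on the whole
  line, as the locale demands, and not just on [0,1).\<close>

definition fill_up :: "nat \<Rightarrow> nat \<Rightarrow> (real \<Rightarrow> bool) \<Rightarrow> real \<Rightarrow> bool" where
  "fill_up N q s x \<longleftrightarrow> s x \<or> N \<le> q \<or> x \<in> {0..<real q / real N}"

lemma antipodal_contraction_fill_up:
  "0 < N \<Longrightarrow> antipodal_contraction (\<lambda>s x. \<not> s x) (fill_up N) N (\<lambda>_. True)"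
  by (rule antipodal_contraction.intro) (simp_all add: fill_up_def fun_eq_iff)

text \<open>A prism involves only the stages \<open>q\<close> and \<open>Suc q\<close>. Maxima with
  numbers between q/N and (q+1)/N send a cube of side 1/N into another of that side, so errors do
  not accumulate with the dimension.\<close>

lemma hemisphere_small:
  assumes "0 < N"
    and "xs \<in> set (antipodal_contraction.hemisphere (\<lambda>s x. \<not> s x) (fill_up N) N (\<lambda>_. True) d)"
  shows "small_simplex (1 / N) d xs"
proof -
  note contraction = antipodal_contraction_fill_up[OF \<open>0 < N\<close>]
  define H where "H = antipodal_contraction.hemisphere (\<lambda>s x. \<not> s x) (fill_up N) N (\<lambda>_. True)"
  note H_simps = antipodal_contraction.hemisphere.simps[OF contraction, folded H_def]
    and cone_def = antipodal_contraction.cone_def[OF contraction]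
  have "xs \<in> set (H d)"
    using assms(2) by (simp add: H_def)
  then show ?thesis
  proof (induction d arbitrary: xs)
    case 0
    then show ?case
      by (auto simp: H_simps small_simplex_def cuts_near_def cut_vector_def cut_sign_def
          intro!: exI[of _ "\<lambda>_. 1"])
  next
    case (Suc d)
    from Suc.prems obtain zs q where zs: "zs \<in> set (H d)" and q: "q < N"
      and xs: "xs \<in> set (prism (fill_up N (Suc q)) (fill_up N q) zs) \<or>
        xs \<in> set (prism (fill_up N (Suc q)) (fill_up N q) (map (\<lambda>s x. \<not> s x) zs))"
      by (auto simp: H_simps cone_def)
    from Suc.IH[OF zs] obtain a where a: "\<And>s. s \<in> set zs \<Longrightarrow> cuts_near (1 / N) d a s"
      unfolding small_simplex_def by blast
    have \<tau>: "real p / real N \<in> {0..1}" "real p / real N \<in> {real q / real N..real q / real N + 1 / N}"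
      if "p \<in> {q, Suc q}" for p
      using that q \<open>0 < N\<close> by (auto simp: field_simps)
    \<comment> \<open>The clause \<open>N \<le> p\<close> can hold only for \<open>p = N\<close>,
      where the threshold is 1 and both sides are true on [0,1).\<close>
    have fill: "fill_up N p s x \<longleftrightarrow> x < real p / real N \<or> s x" if "p \<in> {q, Suc q}" "x \<in> {0..<1}" for p s x
    proof (cases "N \<le> p")
      case True
      with that q have "p = N"
        by auto
      with that \<open>0 < N\<close> show ?thesis
        by (simp add: fill_up_def)
    next
      case False
      with that show ?thesis
        by (auto simp: fill_up_def)
    qed
    from xs show ?case
    proof
      assume xs: "xs \<in> set (prism (fill_up N (Suc q)) (fill_up N q) zs)"
      show ?thesis
        unfolding small_simplex_def
      proof (rule exI[of _ "\<lambda>i. max (a i) (real q / real N)"], rule ballI)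
        fix s assume "s \<in> set xs"
        with set_prism[OF xs] obtain p z where p: "p \<in> {q, Suc q}" and z: "z \<in> set zs"
          and s: "s = fill_up N p z"
          by blast
        from a[OF z, unfolded cuts_near_def] obtain t where t: "cut_vector d t" "\<And>i. t i \<in> {a i..a i + 1 / N}"
            "\<And>x. x \<in> {0..<1} \<Longrightarrow> z x = cut_sign t x"
          by auto
        let ?t = "\<lambda>i. max (t i) (real p / real N)"
        have "?t i \<in> {max (a i) (real q / real N)..max (a i) (real q / real N) + 1 / N}" for i
          using t(2)[of i] \<tau>(2)[OF p] by auto
        moreover have "cut_vector (Suc d) ?t"
          using cut_vector_mono[OF cut_vector_max[OF t(1) \<tau>(1)[OF p]]] by simp
        moreover have "s x = cut_sign ?t x" if "x \<in> {0..<1}" for x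
          using that t(3) fill[OF p] by (simp add: s cut_sign_max)
        ultimately show "cuts_near (1 / N) (Suc d) (\<lambda>i. max (a i) (real q / real N)) s"
          by (intro cuts_nearI)
      qed
    next
      assume xs: "xs \<in> set (prism (fill_up N (Suc q)) (fill_up N q) (map (\<lambda>s x. \<not> s x) zs))"
      let ?a = "case_nat (real q / real N) (\<lambda>i. max (a i) (real q / real N))"
      show ?thesis
        unfolding small_simplex_def
      proof (rule exI[of _ ?a], rule ballI)
        fix s assume "s \<in> set xs"
        with set_prism[OF xs] obtain p z where p: "p \<in> {q, Suc q}" and z: "z \<in> set zs"
          and s: "s = fill_up N p (\<lambda>x. \<not> z x)"
          unfolding set_map by blast
        from a[OF z, unfolded cuts_near_def] obtain t where t: "cut_vector d t" "\<And>i. t i \<in> {a i..a i + 1 / N}"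
            "\<And>x. x \<in> {0..<1} \<Longrightarrow> z x = cut_sign t x"
          by auto
        let ?t = "case_nat (real p / real N) (\<lambda>i. max (t i) (real p / real N))"
        have "max (t i) (real p / real N)
              \<in> {max (a i) (real q / real N)..max (a i) (real q / real N) + 1 / N}" for i
          using t(2)[of i] \<tau>(2)[OF p] by auto
        then have "?t i \<in> {?a i..?a i + 1 / N}" for i
          using \<tau>(2)[OF p] by (cases i) auto
        moreover have "cut_vector (Suc d) ?t"
          using cut_vector_case_nat[OF cut_vector_max[OF t(1)]] \<tau>(1)[OF p] by simp
        moreover have "s x = cut_sign ?t x" if "x \<in> {0..<1}" for x
          using that t(3) fill[OF p] cut_sign_case_nat_max[OF t(1) _ \<tau>(1)[OF p], of x]
          by (simp add: s)
        ultimately show "cuts_near (1 / N) (Suc d) ?a s"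
          by (intro cuts_nearI)
      qed
    qed
  qed
qed

section \<open>Passage to the limit in Tucker's lemma\<close>

lemma bounded_coordinates_subsequence:
  fixes T :: "nat \<Rightarrow> nat \<Rightarrow> real"
  assumes "\<And>n i. T n i \<in> {0..1}"
  shows "\<exists>\<phi> t. strict_mono (\<phi> :: nat \<Rightarrow> nat) \<and> (\<forall>i<d. (\<lambda>n. T (\<phi> n) i) \<longlonglongrightarrow> t i)"
proof (induction d)
  case 0
  show ?case
    by (auto intro: exI[of _ id] simp: strict_mono_def)
next
  case (Suc d)
  then obtain \<phi> t where \<phi>: "strict_mono \<phi>" "\<forall>i<d. (\<lambda>n. T (\<phi> n) i) \<longlonglongrightarrow> t i"
    by blast
  have "seq_compact {0..1::real}"
    by (simp add: compact_imp_seq_compact)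
  then obtain l r where r: "strict_mono r" "((\<lambda>n. T (\<phi> n) d) \<circ> r) \<longlonglongrightarrow> l"
    using assms unfolding seq_compact_def by meson
  have "(\<lambda>n. T ((\<phi> \<circ> r) n) i) \<longlonglongrightarrow> (t(d := l)) i" if "i < Suc d" for i
    using \<phi>(2) r LIMSEQ_subseq_LIMSEQ[OF _ r(1), of "\<lambda>n. T (\<phi> n) i" "t i"] that
    by (cases "i = d") (auto simp: o_def)
  moreover have "strict_mono (\<phi> \<circ> r)"
    using \<phi>(1) r(1) by (rule strict_mono_o)
  ultimately show ?case
    by blast
qed

text \<open>The label is the index of a largest \<open>\<bar>F\<bar>\<close> with the sign of
  \<open>F\<close> there. Opposite labels in a small simplex bound every
  \<open>\<bar>F\<bar>\<close> at one cut vector by its variation to a nearby one; shrinking the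
  mesh gives a common zero in the limit.\<close>

theorem borsuk_ulam_cuts:
  fixes F :: "'r \<Rightarrow> (real \<Rightarrow> bool) \<Rightarrow> real"
  assumes "finite R"
    and odd: "\<And>r s. r \<in> R \<Longrightarrow> F r (\<lambda>x. \<not> s x) = - F r s"
    and local: "\<And>r s s'. r \<in> R \<Longrightarrow> (\<And>x. x \<in> {0..<1} \<Longrightarrow> s x = s' x) \<Longrightarrow> F r s = F r s'"
    and continuous: "\<And>r u t. r \<in> R \<Longrightarrow> (\<And>n. cut_vector (card R) (u n)) \<Longrightarrow>
      (\<And>i. (\<lambda>n. u n i) \<longlonglongrightarrow> t i) \<Longrightarrow> (\<lambda>n. F r (cut_sign (u n))) \<longlonglongrightarrow> F r (cut_sign t)"
  shows "\<exists>t. cut_vector (card R) t \<and> (\<forall>r\<in>R. F r (cut_sign t) = 0)"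
proof (rule ccontr)
  assume contra: "\<not> ?thesis"
  define d where "d = card R"
  obtain e where e: "bij_betw e {..<d} R"
    unfolding d_def using ex_bij_betw_nat_finite[OF \<open>finite R\<close>] by (auto simp: atLeast0LessThan)
  then have eR: "e r \<in> R" if "r < d" for r
    using that by (auto simp: bij_betw_def)
  \<comment> \<open>The choice sees absolute values only, so \<open>s\<close> and its negation get
    the same index.\<close>
  define rho where "rho = (\<lambda>s. SOME r. r < d \<and> (\<forall>r'<d. \<bar>F (e r') s\<bar> \<le> \<bar>F (e r) s\<bar>))"
  have "d \<noteq> 0"
  proof
    assume "d = 0"
    then have "R = {}"
      using \<open>finite R\<close> by (simp add: d_def)
    moreover have "cut_vector (card R) (\<lambda>_. 1)"
      by (simp add: cut_vector_def)
    ultimately show False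
      using contra by simp
  qed
  have rho: "rho s < d \<and> (\<forall>r'<d. \<bar>F (e r') s\<bar> \<le> \<bar>F (e (rho s)) s\<bar>)" for s
  proof -
    have "\<exists>r\<in>{..<d}. \<bar>F (e r) s\<bar> = Max ((\<lambda>r. \<bar>F (e r) s\<bar>) ` {..<d})"
      using Max_in[of "(\<lambda>r. \<bar>F (e r) s\<bar>) ` {..<d}"] \<open>d \<noteq> 0\<close> by fastforce
    then have "\<exists>r. r < d \<and> (\<forall>r'<d. \<bar>F (e r') s\<bar> \<le> \<bar>F (e r) s\<bar>)"
      by auto
    then show ?thesis
      unfolding rho_def by (rule someI_ex)
  qed
  have rho_not: "rho (\<lambda>x. \<not> s x) = rho s" for s
    unfolding rho_def using odd eR by (intro arg_cong[where f = Eps]) (auto simp: fun_eq_iff)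
  define lab where "lab = (\<lambda>s. 2 * rho s + (if F (e (rho s)) s > 0 then 0 else 1))"
  have lab_div: "lab s div 2 = rho s" and lab_even: "even (lab s) \<longleftrightarrow> F (e (rho s)) s > 0" for s
    by (auto simp: lab_def)
  \<comment> \<open>A value 0 would give \<open>s\<close> and its negation the same label. By
    maximality of the index it would make all \<open>F r\<close> vanish, against
    \<open>contra\<close>.\<close>
  have nonzero: "F (e (rho s)) s \<noteq> 0"
    if "cut_vector d t" "\<And>x. x \<in> {0..<1} \<Longrightarrow> s x = cut_sign t x" for s t
  proof
    assume 0: "F (e (rho s)) s = 0"
    have "F r (cut_sign t) = 0" if "r \<in> R" for r
    proof -
      obtain r' where "r' < d" "r = e r'"
        using e \<open>r \<in> R\<close> by (auto simp: bij_betw_def)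
      then have "F r s = 0"
        using rho[of s] 0 by auto
      then show ?thesis
        using local[OF \<open>r \<in> R\<close>, of s "cut_sign t"] \<open>\<And>x. x \<in> {0..<1} \<Longrightarrow> s x = cut_sign t x\<close> by simp
    qed
    with contra \<open>cut_vector d t\<close> show False
      by (auto simp: d_def)
  qed
  \<comment> \<open>The maximal index may vary with \<open>n\<close>; the sum over all of
    \<open>R\<close> is a bound that does not mention it.\<close>
  define P where "P = (\<lambda>n t u. cut_vector d t \<and> cut_vector d u \<and> (\<forall>i. \<bar>t i - u i\<bar> \<le> 1 / Suc n) \<and>
      (\<forall>r\<in>R. \<bar>F r (cut_sign t)\<bar> \<le> (\<Sum>r'\<in>R. \<bar>F r' (cut_sign t) - F r' (cut_sign u)\<bar>)))"
  have "\<exists>t u. P n t u" for n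
  proof -
    define H where "H = antipodal_contraction.hemisphere (\<lambda>s x. \<not> s x) (fill_up (Suc n)) (Suc n) (\<lambda>_. True)"
    have "antipodal_contraction (\<lambda>s x. \<not> s x) (fill_up (Suc n)) (Suc n) (\<lambda>_. True)"
      by (rule antipodal_contraction_fill_up) simp
    note tucker = antipodal_contraction.tucker[OF this, folded H_def, of d lab]
    have small: "small_simplex (1 / Suc n) d xs" if "d' \<le> d" "xs \<in> set (H d')" for d' xs
      using small_simplex_mono[OF hemisphere_small[of "Suc n" xs d']] that by (simp add: H_def)
    have "lab (\<lambda>x. \<not> s x) = opposite (lab s)" if "d' \<le> d" "xs \<in> set (H d')" "s \<in> set xs" for d' xs s
    proof -
      from small[OF that(1,2)] \<open>s \<in> set xs\<close>
      obtain a where "cuts_near (1 / Suc n) d a s"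
        unfolding small_simplex_def by blast
      then have "F (e (rho s)) s \<noteq> 0"
        by (rule cuts_nearE) (rule nonzero)
      then show ?thesis
        using odd[OF eR, of "rho s" s] rho[of s]
        by (auto simp: lab_def rho_not opposite_def)
    qed
    moreover have "lab s div 2 < d" for s
      using rho by (simp add: lab_div)
    ultimately obtain d' xs x y where d': "d' \<le> d" and xs: "xs \<in> set (H d')"
      and x: "x \<in> set xs" and y: "y \<in> set xs" and xy: "lab y = opposite (lab x)"
      using tucker by blast
    from small[OF d' xs] x y obtain a where near: "cuts_near (1 / Suc n) d a x" "cuts_near (1 / Suc n) d a y"
      unfolding small_simplex_def by blast
    from near(1)[unfolded cuts_near_def] obtain t where
        t: "cut_vector d t" "\<And>i. t i \<in> {a i..a i + 1 / Suc n}" "\<And>z. z \<in> {0..<1} \<Longrightarrow> x z = cut_sign t z"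
      by auto
    from near(2)[unfolded cuts_near_def] obtain u where
        u: "cut_vector d u" "\<And>i. u i \<in> {a i..a i + 1 / Suc n}" "\<And>z. z \<in> {0..<1} \<Longrightarrow> y z = cut_sign u z"
      by auto
    have Fx: "F r (cut_sign t) = F r x" and Fy: "F r (cut_sign u) = F r y" if "r \<in> R" for r
      using local[OF that, of x "cut_sign t"] local[OF that, of y "cut_sign u"] t(3) u(3) by auto
    have "rho y = rho x"
      using arg_cong[OF xy, of "\<lambda>l. l div 2"] by (simp add: lab_div)
    moreover have "F (e (rho x)) x > 0 \<longleftrightarrow> \<not> F (e (rho y)) y > 0"
      using arg_cong[OF xy, of even] by (simp add: lab_even)
    \<comment> \<open>At this common index one value is positive and the other is not, so their
      difference dominates each of them.\<close>
    ultimately have *: "\<bar>F (e (rho x)) x\<bar> \<le> \<bar>F (e (rho x)) x - F (e (rho x)) y\<bar>"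
      by auto
    have "\<bar>F r (cut_sign t)\<bar> \<le> (\<Sum>r'\<in>R. \<bar>F r' (cut_sign t) - F r' (cut_sign u)\<bar>)" if "r \<in> R" for r
    proof -
      obtain r' where "r' < d" "r = e r'"
        using e \<open>r \<in> R\<close> by (auto simp: bij_betw_def)
      then have "\<bar>F r (cut_sign t)\<bar> \<le> \<bar>F (e (rho x)) x - F (e (rho x)) y\<bar>"
        using rho[of x] * Fx[OF \<open>r \<in> R\<close>] by force
      also have "\<dots> = (\<Sum>r'\<in>{e (rho x)}. \<bar>F r' (cut_sign t) - F r' (cut_sign u)\<bar>)"
        using rho[of x] eR by (simp add: Fx Fy)
      also have "\<dots> \<le> (\<Sum>r'\<in>R. \<bar>F r' (cut_sign t) - F r' (cut_sign u)\<bar>)"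
        using rho[of x] eR \<open>finite R\<close> by (intro sum_mono2) auto
      finally show ?thesis .
    qed
    moreover have "\<bar>t i - u i\<bar> \<le> 1 / Suc n" for i
      using t(2)[of i] u(2)[of i] by auto
    ultimately show ?thesis
      using t(1) u(1) unfolding P_def by blast
  qed
  then obtain T U where "\<And>n. P n (T n) (U n)"
    by metis
  then have T: "\<And>n. cut_vector d (T n)" and U: "\<And>n. cut_vector d (U n)"
    and TU: "\<And>n i. \<bar>T n i - U n i\<bar> \<le> 1 / Suc n"
    and F: "\<And>n r. r \<in> R \<Longrightarrow> \<bar>F r (cut_sign (T n))\<bar>
        \<le> (\<Sum>r'\<in>R. \<bar>F r' (cut_sign (T n)) - F r' (cut_sign (U n))\<bar>)"
    unfolding P_def by blast+
  have "T n i \<in> {0..1}" for n i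
    using T by (auto simp: cut_vector_def)
  from bounded_coordinates_subsequence[of T d, OF this]
  obtain \<phi> t where \<phi>: "strict_mono \<phi>" and lim: "\<And>i. i < d \<Longrightarrow> (\<lambda>n. T (\<phi> n) i) \<longlonglongrightarrow> t i"
    by blast
  define l where "l = (\<lambda>i. if i < d then t i else 1)"
  have Tl: "(\<lambda>n. T (\<phi> n) i) \<longlonglongrightarrow> l i" for i
    using lim T by (auto simp: l_def cut_vector_def)
  have Ul: "(\<lambda>n. U (\<phi> n) i) \<longlonglongrightarrow> l i" for i
  proof -
    have "(\<lambda>n. T (\<phi> n) i - U (\<phi> n) i) \<longlonglongrightarrow> 0"
    proof (rule Lim_null_comparison)
      show "\<forall>\<^sub>F n in sequentially. norm (T (\<phi> n) i - U (\<phi> n) i) \<le> 1 / Suc (\<phi> n)"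
        using TU by simp
      show "(\<lambda>n. 1 / real (Suc (\<phi> n))) \<longlonglongrightarrow> 0"
        using LIMSEQ_subseq_LIMSEQ[OF LIMSEQ_inverse_real_of_nat \<phi>] by (simp add: o_def inverse_eq_divide)
    qed
    from tendsto_diff[OF Tl[of i] this] show ?thesis
      by simp
  qed
  have "cut_vector d l"
    unfolding cut_vector_def
  proof (intro conjI allI impI)
    fix i
    show "l i \<in> {0..1}"
      by (rule closed_sequentially[OF _ _ Tl]) (use T in \<open>auto simp: cut_vector_def\<close>)
  qed (simp add: l_def)
  moreover have "F r (cut_sign l) = 0" if "r \<in> R" for r
  proof -
    have FT: "(\<lambda>n. F r' (cut_sign (T (\<phi> n)))) \<longlonglongrightarrow> F r' (cut_sign l)"
      and FU: "(\<lambda>n. F r' (cut_sign (U (\<phi> n)))) \<longlonglongrightarrow> F r' (cut_sign l)" if "r' \<in> R" for r'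
      using continuous[OF that, of "\<lambda>n. T (\<phi> n)" l] continuous[OF that, of "\<lambda>n. U (\<phi> n)" l] T U Tl Ul
      by (auto simp: d_def)
    have sum: "(\<lambda>n. \<Sum>r'\<in>R. \<bar>F r' (cut_sign (T (\<phi> n))) - F r' (cut_sign (U (\<phi> n)))\<bar>)
        \<longlonglongrightarrow> (\<Sum>r'\<in>R. \<bar>F r' (cut_sign l) - F r' (cut_sign l)\<bar>)"
      by (intro tendsto_sum tendsto_rabs tendsto_diff FT FU)
    have "(\<lambda>n. \<bar>F r (cut_sign (T (\<phi> n)))\<bar>) \<longlonglongrightarrow> \<bar>F r (cut_sign l)\<bar>"
      by (intro tendsto_rabs FT that)
    from LIMSEQ_le[OF this sum] have "\<bar>F r (cut_sign l)\<bar> \<le> (\<Sum>r'\<in>R. \<bar>F r' (cut_sign l) - F r' (cut_sign l)\<bar>)"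
      using F[OF that] by blast
    then show ?thesis
      by simp
  qed
  ultimately show False
    using contra by (auto simp: d_def)
qed

section \<open>Absolutely continuous measures and cut vectors\<close>

lemma
  assumes "ac_measure_01 \<mu>"
  shows ac_measure_01_sets: "A \<in> sets \<mu> \<longleftrightarrow> A \<subseteq> {0..1} \<and> A \<in> sets borel"
    and ac_measure_01_finite: "finite_measure \<mu>"
    and ac_measure_01_null: "finite A \<Longrightarrow> A \<subseteq> {0..1} \<Longrightarrow> A \<in> null_sets \<mu>"
proof -
  have sets: "sets \<mu> = sets (restrict_space borel {0..1})"
    and ac: "absolutely_continuous (restrict_space lborel {0..1}) \<mu>"
    using assms by (auto simp: ac_measure_01_def)
  show "A \<in> sets \<mu> \<longleftrightarrow> A \<subseteq> {0..1} \<and> A \<in> sets borel"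
    unfolding sets by (subst sets_restrict_space_iff) auto
  show "finite_measure \<mu>"
    using assms by (simp add: ac_measure_01_def)
  assume "finite A" "A \<subseteq> {0..1}"
  then have "A \<in> null_sets (restrict_space lborel {0..1})"
    using finite_imp_null_set_lborel by (subst null_sets_restrict_space) auto
  with ac show "A \<in> null_sets \<mu>"
    by (auto simp: absolutely_continuous_def)
qed

text \<open>Restricting to [0,1) avoids the junk values of \<open>cut_sign\<close>. The integral of
  a nonintegrable function is 0 by default, so oddness holds for every \<open>s\<close>.\<close>

definition signed_mass :: "(real \<Rightarrow> bool) \<Rightarrow> real measure \<Rightarrow> real" where
  "signed_mass s \<mu> = (\<integral>x. (if s x then 1 else - 1) * indicator {0..<1} x \<partial>\<mu>)"

lemma signed_mass_not: "signed_mass (\<lambda>x. \<not> s x) \<mu> = - signed_mass s \<mu>"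
  unfolding signed_mass_def integral_minus[symmetric]
  by (intro Bochner_Integration.integral_cong) auto

lemma signed_mass_cong: "(\<And>x. x \<in> {0..<1} \<Longrightarrow> s x = s' x) \<Longrightarrow> signed_mass s \<mu> = signed_mass s' \<mu>"
  unfolding signed_mass_def
  by (intro Bochner_Integration.integral_cong) (auto simp: indicator_def)

definition cut_interval :: "nat \<Rightarrow> (nat \<Rightarrow> real) \<Rightarrow> nat \<Rightarrow> real set" where
  "cut_interval d t j = {x \<in> {0..1}. Suc (card {i. i < d \<and> t i \<le> x}) = j}"

lemma is_interval_cut_interval: "is_interval (cut_interval d t j)"
  unfolding is_interval_1
proof (intro ballI allI impI)
  fix a b x
  assume ab: "a \<in> cut_interval d t j" "b \<in> cut_interval d t j" and x: "a \<le> x \<and> x \<le> b"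
  then have "card {i. i < d \<and> t i \<le> a} \<le> card {i. i < d \<and> t i \<le> x}"
    "card {i. i < d \<and> t i \<le> x} \<le> card {i. i < d \<and> t i \<le> b}"
    by (auto intro!: card_mono)
  with ab x show "x \<in> cut_interval d t j"
    by (auto simp: cut_interval_def)
qed

lemma card_cuts_le: "card {i. i < d \<and> P i} \<le> (d :: nat)"
  using card_mono[of "{..<d}" "{i. i < d \<and> P i}"] by auto

lemma interval_partition_cut_interval: "interval_partition_01 (Suc d) (cut_interval d t)"
  unfolding interval_partition_01_def
  using is_interval_cut_interval card_cuts_le[of d] by (auto simp: cut_interval_def)

lemma odd_part_cut_interval:
  "odd_part (Suc d) (cut_interval d t) = {x \<in> {0..1}. even (card {i. i < d \<and> t i \<le> x})}"
  using card_cuts_le[of d] by (auto simp: odd_part_def cut_interval_def)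

lemma even_part_cut_interval:
  "even_part (Suc d) (cut_interval d t) = {x \<in> {0..1}. odd (card {i. i < d \<and> t i \<le> x})}"
  using card_cuts_le[of d] by (auto simp: even_part_def cut_interval_def)

lemma cut_interval_parts_borel:
  "odd_part n (cut_interval d t) \<in> sets borel" "even_part n (cut_interval d t) \<in> sets borel"
  unfolding odd_part_def even_part_def
  by (intro sets.finite_UN; simp add: real_interval_borel_measurable is_interval_cut_interval)+

lemma cut_sign_eq:
  assumes "cut_vector d t" "x < 1"
  shows "cut_sign t x \<longleftrightarrow> even (card {i. i < d \<and> t i \<le> x})"
proof -
  have "{i. t i \<le> x} = {i. i < d \<and> t i \<le> x}"
    using assms by (auto simp: cut_vector_def not_le[symmetric])
  then show ?thesis
    by (simp add: cut_sign_def)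
qed

lemma cut_sign_integrand:
  assumes "cut_vector d t"
  shows "(if cut_sign t x then 1 else - 1) * indicator {0..<1} x
    = (indicator (odd_part (Suc d) (cut_interval d t) - {1}) x
       - indicator (even_part (Suc d) (cut_interval d t) - {1}) x :: real)"
  using cut_sign_eq[OF assms]
  by (auto simp: indicator_def odd_part_cut_interval even_part_cut_interval)

lemma cut_sign_integrand_measurable:
  assumes "ac_measure_01 \<mu>" "cut_vector d t"
  shows "(\<lambda>x. (if cut_sign t x then 1 else - 1) * indicator {0..<1} x :: real) \<in> borel_measurable \<mu>"
proof -
  have [measurable]: "odd_part (Suc d) (cut_interval d t) - {1} \<in> sets \<mu>"
    "even_part (Suc d) (cut_interval d t) - {1} \<in> sets \<mu>"
    using cut_interval_parts_borel ac_measure_01_sets[OF assms(1)]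
    by (auto simp: odd_part_cut_interval even_part_cut_interval)
  show ?thesis
    unfolding cut_sign_integrand[OF assms(2)] by measurable
qed

text \<open>The two sides could differ only by the mass of the point 1, which is null by absolute
  continuity.\<close>

lemma disc_cut_interval:
  assumes ac: "ac_measure_01 \<mu>" and t: "cut_vector d t"
  shows "disc (Suc d) (cut_interval d t) \<mu> = signed_mass (cut_sign t) \<mu>"
proof -
  interpret finite_measure \<mu>
    by (rule ac_measure_01_finite[OF ac])
  let ?A = "odd_part (Suc d) (cut_interval d t)" and ?B = "even_part (Suc d) (cut_interval d t)"
  have A: "?A \<in> sets \<mu>" and B: "?B \<in> sets \<mu>"
    using cut_interval_parts_borel ac_measure_01_sets[OF ac]
    by (auto simp: odd_part_cut_interval even_part_cut_interval)
  have null: "{1} \<in> null_sets \<mu>"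
    by (rule ac_measure_01_null[OF ac]) auto
  have "?A - {1} \<in> sets \<mu>" "?B - {1} \<in> sets \<mu>"
    using A B null by auto
  then have "signed_mass (cut_sign t) \<mu> = measure \<mu> (?A - {1}) - measure \<mu> (?B - {1})"
    unfolding signed_mass_def cut_sign_integrand[OF t]
    by (subst Bochner_Integration.integral_diff)
      (auto simp: integrable_indicator_iff emeasure_finite less_top[symmetric] sets.sets_into_space Int_absorb2)
  then show ?thesis
    using measure_Diff_null_set[OF A null] measure_Diff_null_set[OF B null] by (simp add: disc_def)
qed

text \<open>Dominated convergence: off the finitely many limit cuts below index \<open>d\<close>,
  which form a null set, each such cut is eventually on the same side of \<open>x\<close> as its
  limit.\<close>

lemma tendsto_signed_mass:
  assumes ac: "ac_measure_01 \<mu>" and u: "\<And>n. cut_vector d (u n)"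
    and lim: "\<And>i. (\<lambda>n. u n i) \<longlonglongrightarrow> t i"
  shows "(\<lambda>n. signed_mass (cut_sign (u n)) \<mu>) \<longlonglongrightarrow> signed_mass (cut_sign t) \<mu>"
proof -
  interpret finite_measure \<mu>
    by (rule ac_measure_01_finite[OF ac])
  have t: "cut_vector d t"
    unfolding cut_vector_def
  proof (intro conjI allI impI)
    fix i
    show "t i \<in> {0..1}"
      by (rule closed_sequentially[OF _ _ lim]) (use u in \<open>auto simp: cut_vector_def\<close>)
    assume "d \<le> i"
    then have "(\<lambda>n. u n i) = (\<lambda>_. 1)"
      using u by (auto simp: cut_vector_def)
    then show "t i = 1"
      using LIMSEQ_unique[OF lim[of i]] by auto
  qed
  have "t ` {..<d} \<in> null_sets \<mu>"
    using t by (intro ac_measure_01_null[OF ac]) (auto simp: cut_vector_def)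
  then have "AE x in \<mu>. x \<notin> t ` {..<d}"
    by (rule AE_not_in)
  then have pointwise: "AE x in \<mu>. (\<lambda>n. (if cut_sign (u n) x then 1 else - 1) * indicator {0..<1} x :: real)
      \<longlonglongrightarrow> (if cut_sign t x then 1 else - 1) * indicator {0..<1} x"
  proof eventually_elim
    case (elim x)
    show ?case
    proof (cases "x \<in> {0..<1}")
      case True
      have "\<forall>\<^sub>F n in sequentially. u n i \<le> x \<longleftrightarrow> t i \<le> x" if "i < d" for i
      proof (cases "t i < x")
        case True
        show ?thesis
          using order_tendstoD(2)[OF lim True] True by (auto elim: eventually_mono)
      next
        case False
        with elim that have "x < t i"
          by force
        then show ?thesis
          using order_tendstoD(1)[OF lim \<open>x < t i\<close>] by (auto elim: eventually_mono)
      qed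
      then have "\<forall>\<^sub>F n in sequentially. \<forall>i\<in>{..<d}. u n i \<le> x \<longleftrightarrow> t i \<le> x"
        by (intro eventually_ball_finite) auto
      then have "\<forall>\<^sub>F n in sequentially. cut_sign (u n) x = cut_sign t x"
      proof eventually_elim
        case (elim n)
        then have "{i. i < d \<and> u n i \<le> x} = {i. i < d \<and> t i \<le> x}"
          by auto
        then show ?case
          using True by (simp add: cut_sign_eq[OF u] cut_sign_eq[OF t])
      qed
      then show ?thesis
        by (intro tendsto_eventually) (auto elim: eventually_mono)
    qed simp
  qed
  show ?thesis
    unfolding signed_mass_def
  proof (rule integral_dominated_convergence[where w = "\<lambda>_. 1"])
    show "AE x in \<mu>. norm ((if cut_sign (u n) x then 1 else - 1) * indicator {0..<1} x :: real) \<le> 1" for n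
      by (auto simp: indicator_def)
  qed (use pointwise cut_sign_integrand_measurable[OF ac] t u in auto)
qed

section \<open>Simultaneous balancing of all collections\<close>

theorem theorem3p4:
  fixes m n :: nat and Ms :: "nat \<Rightarrow> real measure set" and k :: "nat \<Rightarrow> nat"
  assumes "n \<ge> 1"
    and "\<forall>i\<in>{1..m}. finite (Ms i)"
    and "\<forall>i\<in>{1..m}. \<forall>\<mu>\<in>Ms i. ac_measure_01 \<mu>"
    and "\<forall>i\<in>{1..m}. k i \<ge> 1"
    and "(\<Sum>i\<in>{1..m}. k i) = m + n - 1"
  shows "\<exists>I. interval_partition_01 n I \<and>
           (\<forall>i\<in>{1..m}.
              (\<forall>\<mu>\<in>Ms i. measure \<mu> (odd_part n I) = measure \<mu> (even_part n I))
            \<or> (let M = Max ((\<lambda>\<mu>'. \<bar>disc n I \<mu>'\<bar>) ` Ms i) in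
                 card {\<mu>\<in>Ms i. disc n I \<mu> = M \<or> disc n I \<mu> = - M} \<ge> k i \<and>
                 card {\<mu>\<in>Ms i. disc n I \<mu> = M} \<ge> k i div 2 \<and>
                 card {\<mu>\<in>Ms i. disc n I \<mu> = - M} \<ge> k i div 2))"
proof -
  \<comment> \<open>An arbitrary enumeration fixes what a subsequence is; distinctness later allows
    measures to be counted instead of positions.\<close>
  have "\<forall>i\<in>{1..m}. \<exists>xs. set xs = Ms i \<and> distinct xs"
    using assms(2) finite_distinct_list by blast
  then obtain L where L: "\<And>i. i \<in> {1..m} \<Longrightarrow> set (L i) = Ms i \<and> distinct (L i)"
    by metis
  define R where "R = (SIGMA i:{1..m}. {1..<k i})"
  have "card R = (\<Sum>i\<in>{1..m}. k i - 1)"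
    by (simp add: R_def)
  moreover have "(\<Sum>i\<in>{1..m}. k i - 1) + m = (\<Sum>i\<in>{1..m}. k i - 1 + 1)"
    by (simp only: sum.distrib) simp
  moreover have "(\<Sum>i\<in>{1..m}. k i - 1 + 1) = (\<Sum>i\<in>{1..m}. k i)"
    using assms(4) by (intro sum.cong refl le_add_diff_inverse2) blast
  \<comment> \<open>For \<open>m = 0\<close> the hypothesis \<open>n \<ge> 1\<close> excludes the
    truncated case \<open>n = 0\<close>, leaving \<open>n = 1\<close> and no cuts.\<close>
  ultimately have card_R: "n = Suc (card R)"
    using assms(1,5) by linarith
  define F where "F = (\<lambda>(i, r) s. imbalance r (signed_mass s) (L i))"
  have "\<exists>t. cut_vector (card R) t \<and> (\<forall>p\<in>R. F p (cut_sign t) = 0)"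
  proof (rule borsuk_ulam_cuts)
    show "finite R"
      by (simp add: R_def)
    show "F p (\<lambda>x. \<not> s x) = - F p s" for p s
      by (cases p) (simp add: F_def signed_mass_not[abs_def] imbalance_uminus)
    show "F p s = F p s'" if "\<And>x. x \<in> {0..<1} \<Longrightarrow> s x = s' x" for p s s'
    proof -
      have "signed_mass s = signed_mass s'"
        by (intro ext signed_mass_cong that)
      then show ?thesis
        by (simp add: F_def split_beta)
    qed
    show "(\<lambda>n. F p (cut_sign (u n))) \<longlonglongrightarrow> F p (cut_sign t)"
      if p: "p \<in> R" and "\<And>n. cut_vector (card R) (u n)" "\<And>i. (\<lambda>n. u n i) \<longlonglongrightarrow> t i" for p u t
    proof -
      obtain i r where "p = (i, r)" "i \<in> {1..m}"
        using p by (auto simp: R_def)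
      moreover have "(\<lambda>n. imbalance r (signed_mass (cut_sign (u n))) (L i))
          \<longlonglongrightarrow> imbalance r (signed_mass (cut_sign t)) (L i)"
        using that(2,3) L[OF \<open>i \<in> {1..m}\<close>] assms(3) \<open>i \<in> {1..m}\<close>
        by (intro tendsto_imbalance tendsto_signed_mass[of _ "card R"]) auto
      ultimately show ?thesis
        by (simp add: F_def)
    qed
  qed
  then obtain t where t: "cut_vector (card R) t" and F0: "\<And>p. p \<in> R \<Longrightarrow> F p (cut_sign t) = 0"
    by blast
  define I where "I = cut_interval (card R) t"
  have disc: "disc n I \<mu> = signed_mass (cut_sign t) \<mu>" if "i \<in> {1..m}" "\<mu> \<in> Ms i" for i \<mu>
    using disc_cut_interval[OF _ t] assms(3) that unfolding card_R I_def by blast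
  have "(\<forall>\<mu>\<in>Ms i. measure \<mu> (odd_part n I) = measure \<mu> (even_part n I))
      \<or> (let M = Max ((\<lambda>\<mu>'. \<bar>disc n I \<mu>'\<bar>) ` Ms i) in
           card {\<mu>\<in>Ms i. disc n I \<mu> = M \<or> disc n I \<mu> = - M} \<ge> k i \<and>
           card {\<mu>\<in>Ms i. disc n I \<mu> = M} \<ge> k i div 2 \<and>
           card {\<mu>\<in>Ms i. disc n I \<mu> = - M} \<ge> k i div 2)" if i: "i \<in> {1..m}" for i
  \<comment> \<open>The first case gives alternative (a); it includes an empty collection, for which
    \<open>Max\<close> is unspecified.\<close>
  proof (cases "\<forall>\<mu>\<in>Ms i. disc n I \<mu> = 0")
    case True
    then show ?thesis
      by (auto simp: disc_def)
  next
    case False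
    then obtain \<mu>0 where \<mu>0: "\<mu>0 \<in> Ms i" "disc n I \<mu>0 \<noteq> 0"
      by blast
    define M where "M = Max ((\<lambda>\<mu>'. \<bar>disc n I \<mu>'\<bar>) ` Ms i)"
    have fin: "finite (Ms i)"
      using assms(2) i by blast
    have bound: "\<bar>disc n I \<mu>\<bar> \<le> M" if "\<mu> \<in> Ms i" for \<mu>
      unfolding M_def using fin that by (intro Max_ge) auto
    have "M \<in> (\<lambda>\<mu>'. \<bar>disc n I \<mu>'\<bar>) ` Ms i"
      unfolding M_def using fin \<mu>0(1) by (intro Max_in) auto
    then obtain \<mu>1 where \<mu>1: "\<mu>1 \<in> Ms i" "\<bar>disc n I \<mu>1\<bar> = M"
      by blast
    have "M > 0"
      using bound[OF \<mu>0(1)] \<mu>0(2) by linarith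
    have zero: "imbalance r (signed_mass (cut_sign t)) (L i) = 0" if "r \<in> {1..<k i}" for r
      using F0[of "(i, r)"] that i by (simp add: F_def R_def)
    have "\<exists>ws. subseq ws (L i) \<and> length ws = k i \<and>
        (extremal (signed_mass (cut_sign t)) M ws \<or> extremal (signed_mass (cut_sign t)) (- M) ws)"
      by (rule imbalance_zero_extremal[where x = \<mu>1])
        (use L[OF i] bound disc[OF i] \<mu>1 \<open>M > 0\<close> zero assms(4) i in auto)
    then obtain ws where ws: "subseq ws (L i)" "length ws = k i"
        "extremal (signed_mass (cut_sign t)) M ws \<or> extremal (signed_mass (cut_sign t)) (- M) ws"
      by blast
    have "set ws \<subseteq> Ms i" "distinct ws"
      using ws(1) L[OF i] subseqs_distinctD[of ws "L i"] by (auto dest: subseq_set_subset)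
    note card = extremal_card[OF fin this ws(3)]
    have eq: "{\<mu> \<in> Ms i. P (disc n I \<mu>)} = {\<mu> \<in> Ms i. P (signed_mass (cut_sign t) \<mu>)}" for P
      using disc[OF i] by auto
    have "k i \<le> card {\<mu> \<in> Ms i. disc n I \<mu> = M \<or> disc n I \<mu> = - M} \<and>
        k i div 2 \<le> card {\<mu> \<in> Ms i. disc n I \<mu> = M} \<and>
        k i div 2 \<le> card {\<mu> \<in> Ms i. disc n I \<mu> = - M}"
      unfolding eq[of "\<lambda>y. y = M \<or> y = - M"] eq[of "\<lambda>y. y = M"] eq[of "\<lambda>y. y = - M"]
      using card \<open>M > 0\<close> ws(2) by simp
    then show ?thesis
      unfolding M_def[symmetric] Let_def by (rule disjI2)
  qed
  moreover have "interval_partition_01 n I"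
    unfolding card_R I_def by (rule interval_partition_cut_interval)
  ultimately show ?thesis
    by blast
qed

end
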